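(* Let $G$ be a connected finite loopless multigraph, $q\in V(G)$, and $D$ a divisor on $G$. The $q$-reduced divisor linearly equivalent to $D$ is unique: if $E$ and $E'$ are $q$-reduced divisors on $G$ with $E\sim D$ and $E'\sim D$, then $E=E'$.
   Context: A finite loopless multigraph $G$ has a finite nonempty vertex set $V=V(G)$ and a finite multiset $E(G)$ of unordered pairs $\{v,w\}$ of vertices with $v\neq w$. $G$ is connected if for every nonempty proper subset $S\subsetneq V$ there is at least one edge between $S$ and $V\setminus S$. A divisor on $G$ is a function $D:V\to\mathbb{Z}$; divisors form the abelian group $\mathbb{Z}^V$. Firing a vertex $v$ means sending one chip along each edge incident to $v$: $D(v)$ decreases by the number of edges incident to $v$ (with multiplicity) and $D(w)$ increases by the number of edges between $v$ and $w$ for each $w\neq v$. The firing vector of $v$ is the divisor that firing $v$ adds. The principal divisors are the subgroup generated by all firing vectors; $D\sim D'$ (linear equivalence) means $D-D'$ is principal. Set-firing $S\subseteq V$ means firing every vertex of $S$ exactly once; its net effect is to send one chip along each edge from $S$ to $V\setminus S$. A divisor $D$ is $q$-reduced if $D(v)\ge 0$ for all $v\ne q$ and, for every nonempty $S\subseteq V\setminus\{q\}$, set-firing $S$ creates debt somewhere, i.e. the resulting divisor is negative at some vertex of $S$. *)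

theory Defs
  imports "HOL-Algebra.Algebra" "HOL-Library.Multiset"
begin

record 'a multigraph =
  verts :: "'a set"
  edges :: "'a set multiset"

definition finite_loopless_multigraph :: "'a multigraph \<Rightarrow> bool" where
  "finite_loopless_multigraph G \<longleftrightarrow>
     finite (verts G) \<and> verts G \<noteq> {} \<and>
     (\<forall>e\<in>#edges G. \<exists>v\<in>verts G. \<exists>w\<in>verts G. v \<noteq> w \<and> e = {v, w})"

definition connected_multigraph :: "'a multigraph \<Rightarrow> bool" where
  "connected_multigraph G \<longleftrightarrow>
     (\<forall>S. S \<subset> verts G \<and> S \<noteq> {} \<longrightarrow>
        (\<exists>v\<in>S. \<exists>w\<in>verts G - S. {v, w} \<in># edges G))"

definition degree :: "'a multigraph \<Rightarrow> 'a \<Rightarrow> nat" where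
  "degree G v = size {#e \<in># edges G. v \<in> e#}"

definition num_edges :: "'a multigraph \<Rightarrow> 'a \<Rightarrow> 'a \<Rightarrow> nat" where
  "num_edges G v w = count (edges G) {v, w}"

text \<open>Elements of the divisor group are functions on the vertex set in the sense of
  \<^const>\<open>PiE\<close>: they are \<^const>\<open>undefined\<close> elsewhere, so that HOL equality of divisors
  is equality on the vertices. The group operation, written multiplicatively in the
  library, is pointwise addition.\<close>

definition divisor_group :: "'a multigraph \<Rightarrow> ('a \<Rightarrow> int) monoid" where
  "divisor_group G = product_group (verts G) (\<lambda>_. integer_group)"

abbreviation divisors :: "'a multigraph \<Rightarrow> ('a \<Rightarrow> int) set" where
  "divisors G \<equiv> carrier (divisor_group G)"

definition firing_vector :: "'a multigraph \<Rightarrow> 'a \<Rightarrow> 'a \<Rightarrow> int" where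
  "firing_vector G v =
     (\<lambda>w\<in>verts G. if w = v then - int (degree G v) else int (num_edges G v w))"

definition principal_divisors :: "'a multigraph \<Rightarrow> ('a \<Rightarrow> int) set" where
  "principal_divisors G = generate (divisor_group G) (firing_vector G ` verts G)"

definition linearly_equivalent :: "'a multigraph \<Rightarrow> ('a \<Rightarrow> int) \<Rightarrow> ('a \<Rightarrow> int) \<Rightarrow> bool" where
  "linearly_equivalent G D D' \<longleftrightarrow>
     D \<in> divisors G \<and> D' \<in> divisors G \<and>
     D \<otimes>\<^bsub>divisor_group G\<^esub> inv\<^bsub>divisor_group G\<^esub> D' \<in> principal_divisors G"

definition set_fire :: "'a multigraph \<Rightarrow> 'a set \<Rightarrow> ('a \<Rightarrow> int) \<Rightarrow> 'a \<Rightarrow> int" where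
  "set_fire G S D = (\<lambda>w\<in>verts G. D w + (\<Sum>v\<in>S. firing_vector G v w))"

definition q_reduced :: "'a multigraph \<Rightarrow> 'a \<Rightarrow> ('a \<Rightarrow> int) \<Rightarrow> bool" where
  "q_reduced G q D \<longleftrightarrow>
     D \<in> divisors G \<and>
     (\<forall>v\<in>verts G - {q}. 0 \<le> D v) \<and>
     (\<forall>S. S \<subseteq> verts G - {q} \<and> S \<noteq> {} \<longrightarrow> (\<exists>v\<in>S. set_fire G S D v < 0))"

lemma inv_divisor_group:
  assumes "D \<in> divisors G"
  shows "inv\<^bsub>divisor_group G\<^esub> D = (\<lambda>v\<in>verts G. - D v)"
  using assms unfolding divisor_group_def by (subst inv_product_group) auto

lemma diff_divisor_group:
  assumes "D' \<in> divisors G"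
  shows "D \<otimes>\<^bsub>divisor_group G\<^esub> inv\<^bsub>divisor_group G\<^esub> D' = (\<lambda>v\<in>verts G. D v - D' v)"
  unfolding inv_divisor_group[OF assms]
  by (auto simp: divisor_group_def)

lemma degree_eq_sum_num_edges:
  assumes "finite_loopless_multigraph G" "v \<in> verts G"
  shows "degree G v = (\<Sum>w\<in>verts G - {v}. num_edges G v w)"
proof -
  have fin: "finite (verts G)"
    and E: "\<forall>e\<in>#edges G. \<exists>a\<in>verts G. \<exists>b\<in>verts G. a \<noteq> b \<and> e = {a, b}"
    using assms(1) unfolding finite_loopless_multigraph_def by auto
  have "size {#e \<in># M. v \<in> e#} = (\<Sum>w\<in>verts G - {v}. count M {v, w})"
    if "\<forall>e\<in>#M. \<exists>a\<in>verts G. \<exists>b\<in>verts G. a \<noteq> b \<and> e = {a, b}" for M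
    using that
  proof (induction M)
    case empty
    then show ?case by simp
  next
    case (add e M)
    obtain a b where ab: "a \<in> verts G" "b \<in> verts G" "a \<noteq> b" "e = {a, b}"
      using add.prems by auto
    have "(\<Sum>w\<in>verts G - {v}. count (add_mset e M) {v, w}) =
        (\<Sum>w\<in>verts G - {v}. count M {v, w} + (if {v, w} = e then 1 else 0))"
      by (intro sum.cong) auto
    also have "\<dots> = (\<Sum>w\<in>verts G - {v}. count M {v, w}) +
        card {w \<in> verts G - {v}. {v, w} = e}"
      using fin by (simp add: sum.distrib sum.If_cases Int_def)
    also have "card {w \<in> verts G - {v}. {v, w} = e} = (if v \<in> e then 1 else 0)"
    proof -
      have "{w \<in> verts G - {v}. {v, w} = e} = (if v = a then {b} else if v = b then {a} else {})"
        using ab by (auto simp: doubleton_eq_iff)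
      then show ?thesis using ab by auto
    qed
    finally show ?case using add by auto
  qed
  from this[OF E] show ?thesis unfolding degree_def num_edges_def .
qed

lemma set_fire_net_effect:
  assumes "finite_loopless_multigraph G" "S \<subseteq> verts G" "w \<in> verts G"
  shows "set_fire G S D w =
    (if w \<in> S then D w - int (\<Sum>u\<in>verts G - S. num_edges G w u)
     else D w + int (\<Sum>v\<in>S. num_edges G v w))"
proof (cases "w \<in> S")
  case False
  then show ?thesis using assms(3)
    by (auto simp: set_fire_def firing_vector_def intro!: sum.cong)
next
  case True
  have fin: "finite (verts G)" "finite S"
    using assms unfolding finite_loopless_multigraph_def by (auto intro: finite_subset)
  have "(\<Sum>v\<in>S. firing_vector G v w) =
      firing_vector G w w + (\<Sum>v\<in>S - {w}. firing_vector G v w)"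
    using fin True by (simp add: sum.remove)
  also have "(\<Sum>v\<in>S - {w}. firing_vector G v w) = int (\<Sum>v\<in>S - {w}. num_edges G w v)"
    using assms(3) unfolding of_nat_sum
    by (intro sum.cong) (auto simp: firing_vector_def num_edges_def insert_commute)
  also have "firing_vector G w w = - int (\<Sum>u\<in>verts G - {w}. num_edges G w u)"
    using assms(3) degree_eq_sum_num_edges[OF assms(1,3)] by (simp add: firing_vector_def)
  also have "verts G - {w} = (verts G - S) \<union> (S - {w})"
    using True assms(2) by auto
  also have "(\<Sum>u\<in>(verts G - S) \<union> (S - {w}). num_edges G w u) =
      (\<Sum>u\<in>verts G - S. num_edges G w u) + (\<Sum>u\<in>S - {w}. num_edges G w u)"
    using fin by (intro sum.union_disjoint) auto
  finally show ?thesis using True assms(3) by (simp add: set_fire_def)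
qed

end

theory Submission
  imports Defs
begin

text \<open>Proof by the maximum principle. Since \<open>E\<close> and \<open>E'\<close> are both equivalent to \<open>D\<close>, one
  obtains \<open>E\<close> from \<open>E'\<close> by firing every vertex \<open>v\<close> a net number \<open>f v\<close> of times
  (\<open>principal_divisor_firing_script\<close>), which changes the value at \<open>w\<close> by
  \<open>\<Sum>u\<in>V. (f u - f w) * num_edges G w u\<close>. On the set \<open>A\<close> where the integer-valued \<open>f\<close> is
  maximal, each edge leaving \<open>A\<close> carries away at least one chip, so \<open>f\<close> removes at least as
  much from every vertex of \<open>A\<close> as set-firing \<open>A\<close> does. If \<open>q\<close> were outside \<open>A\<close>, set-firing
  \<open>A\<close> would put some vertex of \<open>A\<close> in debt because \<open>E'\<close> is reduced, and then \<open>E\<close> would be in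
  debt there too. So \<open>f\<close> is maximal at \<open>q\<close> (\<open>q_reduced_script_max\<close>). Exchanging the roles of
  \<open>E\<close> and \<open>E'\<close> replaces \<open>f\<close> by \<open>-f\<close>, so \<open>f\<close> is also minimal at \<open>q\<close>. Hence \<open>f\<close> is constant
  and changes nothing.\<close>

lemma firing_vector_indicator:
  assumes "finite_loopless_multigraph G" "v \<in> verts G" "w \<in> verts G"
  shows "firing_vector G v w =
    (\<Sum>u\<in>verts G. (of_bool (u = v) - of_bool (w = v)) * int (num_edges G w u))"
proof (cases "w = v")
  case True
  have fin: "finite (verts G)"
    using assms(1) unfolding finite_loopless_multigraph_def by auto
  have "(\<Sum>u\<in>verts G. (of_bool (u = v) - of_bool (w = v)) * int (num_edges G w u)) =
      (\<Sum>u\<in>verts G - {v}. - int (num_edges G v u))"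
    using True fin by (subst sum.remove[OF fin assms(2)]) (auto intro!: sum.cong)
  then show ?thesis
    using True assms(2) degree_eq_sum_num_edges[OF assms(1,2)]
    by (simp add: firing_vector_def sum_negf)
next
  case False
  have fin: "finite (verts G)"
    using assms(1) unfolding finite_loopless_multigraph_def by auto
  have "(\<Sum>u\<in>verts G. (of_bool (u = v) - of_bool (w = v)) * int (num_edges G w u)) =
      int (num_edges G w v)"
    using False by (subst sum.remove[OF fin assms(2)]) auto
  then show ?thesis
    using False assms(3) by (simp add: firing_vector_def num_edges_def insert_commute)
qed

text \<open>Writing the effect of a script \<open>f\<close> through the differences \<open>f u - f w\<close> absorbs the
  degree term of the firing vectors and shows that only differences of \<open>f\<close> matter, which is
  what the maximum argument uses. The formula is additive in \<open>f\<close>, so it passes from the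
  generators to the group they generate.\<close>

lemma principal_divisor_firing_script:
  assumes "finite_loopless_multigraph G" "P \<in> principal_divisors G"
  shows "\<exists>f. \<forall>w\<in>verts G. P w = (\<Sum>u\<in>verts G. (f u - f w) * int (num_edges G w u))"
  using assms(2) unfolding principal_divisors_def
proof (induction rule: generate.induct)
  case one
  show ?case
    by (intro exI[of _ "\<lambda>_. 0"]) (simp add: divisor_group_def)
next
  case (incl h)
  then obtain v where "v \<in> verts G" "h = firing_vector G v" by auto
  then show ?case
    using firing_vector_indicator[OF assms(1)]
    by (intro exI[of _ "\<lambda>u. of_bool (u = v)"]) auto
next
  case (inv h)
  then obtain v where v: "v \<in> verts G" "h = firing_vector G v" by auto
  then have "h \<in> divisors G"
    by (simp add: divisor_group_def firing_vector_def)
  then show ?case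
    using v firing_vector_indicator[OF assms(1)]
    by (intro exI[of _ "\<lambda>u. - of_bool (u = v)"])
      (auto simp: inv_divisor_group sum_negf[symmetric] algebra_simps intro!: sum.cong)
next
  case (eng h1 h2)
  then obtain f g where
    "\<forall>w\<in>verts G. h1 w = (\<Sum>u\<in>verts G. (f u - f w) * int (num_edges G w u))"
    "\<forall>w\<in>verts G. h2 w = (\<Sum>u\<in>verts G. (g u - g w) * int (num_edges G w u))"
    by blast
  then show ?case
    by (intro exI[of _ "\<lambda>u. f u + g u"])
      (auto simp: divisor_group_def sum.distrib[symmetric] algebra_simps intro!: sum.cong)
qed

text \<open>Integrality of \<open>f\<close> enters here: outside the set where \<open>f\<close> is maximal it is smaller by
  at least \<open>1\<close>, so the script drains that set at least as fast as a single set-firing.\<close>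

lemma q_reduced_script_max:
  fixes f :: "'a \<Rightarrow> int"
  assumes G: "finite_loopless_multigraph G" and q: "q \<in> verts G"
    and red: "q_reduced G q E'"
    and script: "\<And>w. w \<in> verts G \<Longrightarrow>
      E w = E' w + (\<Sum>u\<in>verts G. (f u - f w) * int (num_edges G w u))"
    and nonneg: "\<And>w. w \<in> verts G - {q} \<Longrightarrow> 0 \<le> E w"
    and v: "v \<in> verts G"
  shows "f v \<le> f q"
proof -
  have fin: "finite (verts G)"
    using G unfolding finite_loopless_multigraph_def by auto
  define m where "m = Max (f ` verts G)"
  define A where "A = {w \<in> verts G. f w = m}"
  have le_m: "f u \<le> m" if "u \<in> verts G" for u
    using that fin by (simp add: m_def)
  have "m \<in> f ` verts G"
    unfolding m_def using fin q by (intro Max_in) auto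
  then have "A \<noteq> {}" by (auto simp: A_def)
  have "q \<in> A"
  proof (rule ccontr)
    assume "q \<notin> A"
    then have A: "A \<subseteq> verts G - {q}" by (auto simp: A_def)
    with \<open>A \<noteq> {}\<close> red obtain w where w: "w \<in> A" "set_fire G A E' w < 0"
      unfolding q_reduced_def by blast
    then have wV: "w \<in> verts G - {q}" using A by auto
    have "(\<Sum>u\<in>verts G. (f u - f w) * int (num_edges G w u)) =
        (\<Sum>u\<in>verts G - A. (f u - f w) * int (num_edges G w u))"
      using w(1) fin by (intro sum.mono_neutral_right) (auto simp: A_def)
    also have "\<dots> \<le> (\<Sum>u\<in>verts G - A. - int (num_edges G w u))"
    proof (rule sum_mono)
      fix u assume u: "u \<in> verts G - A"
      then have "f u \<noteq> m" by (auto simp: A_def)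
      with le_m[of u] u w(1) have "f u - f w \<le> -1" by (auto simp: A_def)
      then show "(f u - f w) * int (num_edges G w u) \<le> - int (num_edges G w u)"
        using mult_right_mono[of "f u - f w" "-1" "int (num_edges G w u)"] by simp
    qed
    finally have "E w \<le> set_fire G A E' w"
      using script[of w] wV w(1) A
      by (subst set_fire_net_effect[OF G]) (auto simp: sum_negf)
    with w(2) nonneg[OF wV] show False by simp
  qed
  then show ?thesis using le_m[OF v] by (simp add: A_def)
qed

theorem mainTheorem7:
  fixes G :: "'a multigraph" and q :: 'a and D E E' :: "'a \<Rightarrow> int"
  assumes "finite_loopless_multigraph G"
    and "connected_multigraph G"
    and "q \<in> verts G"
    and "D \<in> divisors G"
    and "q_reduced G q E" and "q_reduced G q E'"
    and "linearly_equivalent G E D" and "linearly_equivalent G E' D"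
  shows "E = E'"
proof -
  let ?L = "\<lambda>f w. \<Sum>u\<in>verts G. (f u - f w) * int (num_edges G w u)"
  have eq: "\<exists>f. \<forall>w\<in>verts G. F w - D w = ?L f w" if "linearly_equivalent G F D" for F
  proof -
    have "(\<lambda>v\<in>verts G. F v - D v) \<in> principal_divisors G"
      using that diff_divisor_group[OF assms(4)] by (simp add: linearly_equivalent_def)
    from principal_divisor_firing_script[OF assms(1) this] show ?thesis by simp
  qed
  obtain g g' where g: "\<forall>w\<in>verts G. E w - D w = ?L g w"
    and g': "\<forall>w\<in>verts G. E' w - D w = ?L g' w"
    using eq[OF assms(7)] eq[OF assms(8)] by blast
  define f where "f = (\<lambda>u. g u - g' u)"
  have Lf: "?L f w = ?L g w - ?L g' w" for w
    unfolding f_def sum_subtractf[symmetric] by (intro sum.cong) (auto simp: algebra_simps)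
  have Lneg: "?L (\<lambda>u. - f u) w = - ?L f w" for w
    unfolding sum_negf[symmetric] by (intro sum.cong) (auto simp: algebra_simps)
  have script: "E w = E' w + ?L f w" if "w \<in> verts G" for w
    using g g' that Lf[of w] by force
  have script': "E' w = E w + ?L (\<lambda>u. - f u) w" if "w \<in> verts G" for w
    using script[OF that] Lneg[of w] by linarith
  have const: "f v = f q" if "v \<in> verts G" for v
  proof (rule antisym)
    show "f v \<le> f q"
      using assms(5) that
      by (intro q_reduced_script_max[OF assms(1,3,6) script]) (auto simp: q_reduced_def)
    have "- f v \<le> - f q"
      using assms(6) that
      by (intro q_reduced_script_max[where f = "\<lambda>u. - f u", OF assms(1,3,5) script'])
        (auto simp: q_reduced_def)
    then show "f q \<le> f v" by simp
  qed
  have "E w = E' w" if "w \<in> verts G" for w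
    using script[OF that] const that by simp
  moreover have "E \<in> extensional (verts G)" "E' \<in> extensional (verts G)"
    using assms(5,6) by (auto simp: q_reduced_def divisor_group_def PiE_def)
  ultimately show ?thesis by (intro extensionalityI) auto
qed

end
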